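(* For any integers $m,n\geq 2$, $$\log\left(\zeta_{\mathcal P_{m\mathbb N}}(n)\right)=n\sum_{\substack{k\geq 2\\ n\mid k}}\frac{\zeta(k)}{k\,m^k}.$$
   Context: $\mathbb N=\{1,2,3,\dots\}$ and $\zeta$ is the Riemann zeta function. $\mathcal P_{m\mathbb N}$ is the set of integer partitions (including the empty partition) all of whose parts are multiples of $m$. For a partition $\lambda$, $n_\lambda$ is the product of its parts (with $n_\emptyset=1$), and $\zeta_{\mathcal P_{m\mathbb N}}(s):=\sum_{\lambda\in\mathcal P_{m\mathbb N}}n_\lambda^{-s}$ where this converges. *)

theory Defs
  imports "HOL-Analysis.Analysis" "HOL-Library.Multiset"
begin

(* Dirichlet series of the Riemann zeta function: the intended value for real s > 1. *)
definition riemann_zeta :: "real \<Rightarrow> real" where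
  "riemann_zeta s = (\<Sum>\<^sub>\<infinity>j\<in>{1::nat..}. real j powr - s)"

definition positive_multiples :: "nat \<Rightarrow> nat set" where
  "positive_multiples m = {m * j |j. 1 \<le> j}"

(* An integer partition is the finite multiset of its parts. *)
definition partitions_into :: "nat set \<Rightarrow> nat multiset set" where
  "partitions_into S = {p. (\<forall>i\<in>#p. 1 \<le> i) \<and> set_mset p \<subseteq> S}"

definition partition_norm :: "nat multiset \<Rightarrow> nat" where
  "partition_norm p = prod_mset p"

definition partition_zeta_converges :: "nat multiset set \<Rightarrow> real \<Rightarrow> bool" where
  "partition_zeta_converges P s \<longleftrightarrow> (\<lambda>p. real (partition_norm p) powr - s) summable_on P"

(* infsum is 0 if the family is not summable, so the value is meaningful only
   together with partition_zeta_converges. *)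
definition partition_zeta :: "nat multiset set \<Rightarrow> real \<Rightarrow> real" where
  "partition_zeta P s = (\<Sum>\<^sub>\<infinity>p\<in>P. real (partition_norm p) powr - s)"

end

theory Submission
  imports Defs
begin

text \<open>
  The identity is the logarithm of an Euler product. Every multiset of parts is determined by the
  multiplicities of its elements, so for a nonnegative weight \<open>w < 1\<close> on a set \<open>S\<close> with
  \<open>\<Sum>i\<in>S. - ln (1 - w i)\<close> convergent, the sum over all multisets \<open>p\<close> on \<open>S\<close> of the product of the
  weights of the elements of \<open>p\<close> is \<open>\<Prod>i\<in>S. 1 / (1 - w i)\<close>
  (\<open>has_sum_multisets_finite\<close> for finite \<open>S\<close>, \<open>has_sum_multisets\<close> in general, where
  the product appears as the exponential of the sum of logarithms).

  For \<open>w i = i powr - n\<close> on the multiples \<open>i = m * j\<close> of \<open>m\<close>, expanding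
  \<open>- ln (1 - x) = (\<Sum>l\<ge>1. x ^ l / l)\<close> turns the logarithm of the product into the double series
  \<open>\<Sum>j\<ge>1. \<Sum>l\<ge>1. (m * j) powr - (n * l) / l\<close> of nonnegative terms. Summing over \<open>j\<close> first gives
  \<open>\<Sum>l\<ge>1. zeta (n * l) / (l * m ^ (n * l))\<close>
  (\<open>has_sum_zeta_of_has_sum_ln\<close>), and the substitution \<open>k = n * l\<close> gives
  the claim. Convergence everywhere reduces to that of \<open>\<Sum>j. j powr - n\<close> by
  \<open>- ln (1 - x) \<le> 2 * x\<close> for \<open>0 \<le> x \<le> 1/2\<close>.
\<close>

lemma prod_mset_image_nonneg:
  fixes w :: "'a \<Rightarrow> real"
  assumes "\<And>a. a \<in># p \<Longrightarrow> 0 \<le> w a"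
  shows "0 \<le> prod_mset (image_mset w p)"
  using assms by (induction p) auto

lemma has_sum_multisets_finite:
  fixes w :: "'a \<Rightarrow> real"
  assumes "finite A" and "\<And>a. a \<in> A \<Longrightarrow> 0 \<le> w a \<and> w a < 1"
  shows "((\<lambda>p. prod_mset (image_mset w p)) has_sum (\<Prod>a\<in>A. 1 / (1 - w a))) {p. set_mset p \<subseteq> A}"
  using assms
proof (induction A rule: finite_induct)
  case empty
  have "{p. set_mset p \<subseteq> ({}::'a set)} = {{#}}" by auto
  then show ?case by (auto intro: has_sum_finiteI)
next
  case (insert a A)
  let ?W = "\<lambda>p. prod_mset (image_mset w p)"
  let ?P = "\<Prod>b\<in>A. 1 / (1 - w b)"
  let ?M = "{p. set_mset p \<subseteq> A}"
  have IH: "(?W has_sum ?P) ?M" using insert by auto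
  have wa: "0 \<le> w a" "w a < 1" using insert.prems by auto
  have nonneg: "0 \<le> ?W p" if "p \<in> ?M" for p
    using that insert.prems by (intro prod_mset_image_nonneg) auto
  have geo: "((\<lambda>l. w a ^ l) has_sum (1 / (1 - w a))) (UNIV :: nat set)"
    using geometric_sums[of "w a"] wa by (intro sums_nonneg_imp_has_sum) auto
  have inner: "((\<lambda>l. case (p, l) of (p, l) \<Rightarrow> ?W p * w a ^ l) has_sum (?W p * (1 / (1 - w a))))
      (UNIV :: nat set)" for p
    using has_sum_cmult_right[OF geo] by simp
  have outer: "((\<lambda>p. ?W p * (1 / (1 - w a))) has_sum (?P * (1 / (1 - w a)))) ?M"
    by (rule has_sum_cmult_left[OF IH])
  have "((\<lambda>(p, l). ?W p * w a ^ l) has_sum (?P * (1 / (1 - w a)))) (?M \<times> (UNIV :: nat set))"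
    using nonneg wa
    by (intro has_sum_SigmaI[OF inner outer] summable_on_SigmaI[OF inner has_sum_imp_summable[OF outer]])
       auto
  \<comment> \<open>A multiset on \<open>insert a A\<close> is a multiset on \<open>A\<close> together with the multiplicity of \<open>a\<close>.\<close>
  also have "?this \<longleftrightarrow> (?W has_sum (?P * (1 / (1 - w a)))) {p. set_mset p \<subseteq> insert a A}"
  proof (rule has_sum_reindex_bij_witness
      [of _ "\<lambda>q. (filter_mset (\<lambda>x. x \<noteq> a) q, count q a)" "\<lambda>(p, l). p + replicate_mset l a"], goal_cases)
    case (1 x)
    with \<open>a \<notin> A\<close> show ?case
      by (auto simp: not_in_iff[symmetric] split: prod.splits intro!: multiset_eqI)
  next
    case (3 q)
    then show ?case
      by (auto simp: filter_eq_replicate_mset[symmetric] intro!: multiset_eqI)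
  qed (auto split: prod.splits)
  finally show ?case using insert by (simp add: mult.commute)
qed

lemma neg_ln_one_minus_nonneg:
  fixes x :: real
  assumes "0 \<le> x" "x < 1"
  shows "0 \<le> - ln (1 - x)"
  using assms by simp

text \<open>The Euler product for multisets. A finite family of multisets involves only finitely many
  elements, so its sum is at most a finite product, hence at most \<open>exp L\<close>; this gives convergence and
  one inequality. Conversely each finite product is the sum over a sub-family, and these products
  tend to \<open>exp L\<close>.\<close>

lemma has_sum_multisets:
  fixes w :: "'a \<Rightarrow> real"
  assumes w: "\<And>a. a \<in> S \<Longrightarrow> 0 \<le> w a \<and> w a < 1"
    and L: "((\<lambda>a. - ln (1 - w a)) has_sum L) S"
  shows "((\<lambda>p. prod_mset (image_mset w p)) has_sum exp L) {p. set_mset p \<subseteq> S}"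
proof -
  let ?W = "\<lambda>p. prod_mset (image_mset w p)"
  let ?M = "\<lambda>A. {p. set_mset p \<subseteq> A}"
  have prod_eq: "(\<Prod>a\<in>A. 1 / (1 - w a)) = exp (\<Sum>a\<in>A. - ln (1 - w a))"
    if "finite A" "A \<subseteq> S" for A
  proof -
    have "1 / (1 - w a) = exp (- ln (1 - w a))" if "a \<in> A" for a
      using w[of a] that \<open>A \<subseteq> S\<close> by (auto simp: exp_minus inverse_eq_divide)
    then show ?thesis using that by (simp add: exp_sum)
  qed
  have fin: "(?W has_sum exp (\<Sum>a\<in>A. - ln (1 - w a))) (?M A)" if "finite A" "A \<subseteq> S" for A
    using has_sum_multisets_finite[of A w] prod_eq[OF that] that w by (auto simp: subset_iff)
  have nonneg: "0 \<le> ?W p" if "p \<in> ?M S" for p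
    using that w by (intro prod_mset_image_nonneg) auto
  have bound: "sum ?W F \<le> exp L" if F: "finite F" "F \<subseteq> ?M S" for F
  proof -
    let ?A = "\<Union>p\<in>F. set_mset p"
    have A: "finite ?A" "?A \<subseteq> S" using F by auto
    have "sum ?W F \<le> exp (\<Sum>a\<in>?A. - ln (1 - w a))"
      using nonneg A F by (intro finite_sum_le_has_sum[OF fin]) auto
    also have "(\<Sum>a\<in>?A. - ln (1 - w a)) \<le> L"
      using A w by (intro finite_sum_le_has_sum[OF L] neg_ln_one_minus_nonneg) auto
    finally show ?thesis by simp
  qed
  have summable: "?W summable_on ?M S"
    using nonneg bound by (intro nonneg_bdd_above_summable_on bdd_aboveI2[where M = "exp L"]) auto
  have "infsum ?W (?M S) \<le> exp L"
    using summable bound by (rule infsum_le_finite_sums)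
  moreover have "exp L \<le> infsum ?W (?M S)"
  proof (rule tendsto_upperbound)
    show "((\<lambda>A. exp (\<Sum>a\<in>A. - ln (1 - w a))) \<longlongrightarrow> exp L) (finite_subsets_at_top S)"
      using L unfolding has_sum_def by (rule tendsto_exp)
    show "\<forall>\<^sub>F A in finite_subsets_at_top S. exp (\<Sum>a\<in>A. - ln (1 - w a)) \<le> infsum ?W (?M S)"
      using nonneg
      by (intro eventually_finite_subsets_at_top_weakI
            has_sum_mono2[OF fin has_sum_infsum[OF summable]]) auto
  qed auto
  ultimately show ?thesis using summable by (simp add: has_sum_iff)
qed

lemma has_sum_neg_ln_one_minus:
  fixes x :: real
  assumes "0 \<le> x" "x < 1"
  shows "((\<lambda>l. x ^ l / real l) has_sum (- ln (1 - x))) {1..}"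
proof -
  have "(\<lambda>l. x ^ l / real l) sums (- ln (1 - x))"
    using sums_minus[OF ln_series'[of "- x"]] assms by simp
  then have "((\<lambda>l. x ^ l / real l) has_sum (- ln (1 - x))) UNIV"
    using assms by (intro sums_nonneg_imp_has_sum) auto
  \<comment> \<open>The term with \<open>l = 0\<close> vanishes because division by zero yields zero.\<close>
  also have "?this \<longleftrightarrow> ?thesis"
    by (intro has_sum_cong_neutral) (auto simp: not_le)
  finally show ?thesis .
qed

lemma neg_ln_one_minus_le:
  fixes x :: real
  assumes "0 \<le> x" "x \<le> 1/2"
  shows "- ln (1 - x) \<le> 2 * x"
proof -
  have "- ln (1 - x) = ln (1 / (1 - x))" using assms by (simp add: ln_div)
  also have "\<dots> \<le> 1 / (1 - x) - 1" using assms by (intro ln_le_minus_one) auto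
  also have "\<dots> \<le> 2 * x"
  proof -
    have "0 \<le> x * (1 - 2 * x)" using assms by simp
    then show ?thesis using assms by (simp add: field_simps)
  qed
  finally show ?thesis .
qed

lemma summable_on_powr_neg:
  assumes "s > 1"
  shows "(\<lambda>j. real j powr - s) summable_on {1::nat..}"
proof -
  have "(\<lambda>j. real j powr - s) summable_on UNIV"
    using assms by (intro summable_nonneg_imp_summable_on_strong) (auto simp: summable_real_powr_iff)
  then show ?thesis by (rule summable_on_subset) auto
qed

lemma has_sum_riemann_zeta:
  assumes "s > 1"
  shows "((\<lambda>j. real j powr - s) has_sum riemann_zeta s) {1::nat..}"
  unfolding riemann_zeta_def using summable_on_powr_neg[OF assms] by (rule has_sum_infsum)

text \<open>The logarithm of the product \<open>\<Prod>j\<ge>1. 1 / (1 - (m * j) powr - n)\<close> converges, and its expansion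
  may be summed in either order.\<close>

lemma has_sum_zeta_of_has_sum_ln:
  fixes m n :: nat
  assumes m: "m \<ge> 2" and n: "n \<ge> 2"
  shows "\<exists>L. ((\<lambda>j. - ln (1 - real (m * j) powr - real n)) has_sum L) {1..} \<and>
    ((\<lambda>l. riemann_zeta (real (n * l)) / (real l * real m ^ (n * l))) has_sum L) {1..}"
proof -
  define x where "x j = real (m * j) powr - real n" for j
  have x0: "0 \<le> x j" for j by (simp add: x_def)
  have x_le: "x j \<le> 1/2" if "j \<in> {1..}" for j
  proof -
    have "2 \<le> real (m * j)" using m that mult_mono[of 2 m 1 j] by (simp flip: of_nat_mult)
    then have "x j \<le> 2 powr - real n" unfolding x_def by (intro powr_mono2') auto
    also have "\<dots> \<le> 2 powr - 1" using n by (intro powr_mono) auto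
    finally show ?thesis by (simp add: powr_minus)
  qed
  have x_lt: "x j < 1" if "j \<in> {1..}" for j using x_le[OF that] by simp
  have x_pow: "x j ^ l = real j powr - real (n * l) / real m ^ (n * l)"
    if "j \<in> {1..}" for j l
  proof -
    have "x j ^ l = real (m * j) powr - real (n * l)"
      using that m unfolding x_def by (simp add: powr_powr flip: powr_realpow)
    also have "\<dots> = real m powr - real (n * l) * real j powr - real (n * l)"
      by (simp add: powr_mult)
    also have "real m powr - real (n * l) = 1 / real m ^ (n * l)"
      using m powr_realpow[of "real m" "n * l"] by (simp add: powr_minus_divide)
    finally show ?thesis by simp
  qed
  have "(\<lambda>j. 2 * (1 / real m ^ n * real j powr - real n)) summable_on {1::nat..}"
    using n by (intro summable_on_cmult_right summable_on_powr_neg) auto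
  also have "?this \<longleftrightarrow> (\<lambda>j. 2 * x j) summable_on {1::nat..}"
    using x_pow[of _ 1] by (intro summable_on_cong) auto
  finally have "(\<lambda>j. - ln (1 - x j)) summable_on {1..}"
    by (rule summable_on_comparison_test)
       (use x0 x_le x_lt in \<open>auto intro!: neg_ln_one_minus_le neg_ln_one_minus_nonneg\<close>)
  then obtain L where L: "((\<lambda>j. - ln (1 - x j)) has_sum L) {1..}"
    by (auto simp: summable_on_def)
  define f where "f = (\<lambda>(j, l). x j ^ l / real l)"
  have inner: "((\<lambda>l. f (j, l)) has_sum (- ln (1 - x j))) {1..}" if "j \<in> {1..}" for j
    using has_sum_neg_ln_one_minus[OF x0 x_lt[OF that]] by (simp add: f_def)
  have "(f has_sum L) ({1..} \<times> {1..})"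
    using x0 by (intro has_sum_SigmaI[OF inner L]
        summable_on_SigmaI[OF inner has_sum_imp_summable[OF L]]) (auto simp: f_def)
  then have "((\<lambda>(l, j). f (j, l)) has_sum L) ({1..} \<times> {1..})"
    by (subst (asm) has_sum_swap)
  then have "((\<lambda>l. riemann_zeta (real (n * l)) / (real l * real m ^ (n * l))) has_sum L) {1..}"
  proof (rule has_sum_SigmaD)
    fix l :: nat assume l: "l \<in> {1..}"
    have "1 < n * l" using n l mult_mono[of 2 n 1 l] by simp
    then have "((\<lambda>j. real j powr - real (n * l) / (real l * real m ^ (n * l))) has_sum
        (riemann_zeta (real (n * l)) / (real l * real m ^ (n * l)))) {1..}"
      by (intro has_sum_divide_const has_sum_riemann_zeta) (simp flip: of_nat_mult)
    also have "?this \<longleftrightarrow> ((\<lambda>j. case (l, j) of (l, j) \<Rightarrow> f (j, l)) has_sum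
        (riemann_zeta (real (n * l)) / (real l * real m ^ (n * l)))) {1..}"
      by (intro has_sum_cong) (simp add: f_def x_pow mult.commute)
    finally show "((\<lambda>j. case (l, j) of (l, j) \<Rightarrow> f (j, l)) has_sum
        (riemann_zeta (real (n * l)) / (real l * real m ^ (n * l)))) {1..}" .
  qed
  with L show ?thesis by (auto simp: x_def)
qed

lemma powr_partition_norm:
  "real (partition_norm p) powr s = prod_mset (image_mset (\<lambda>i. real i powr s) p)"
  by (induction p) (auto simp: partition_norm_def powr_mult)

theorem corollary2:
  fixes m n :: nat
  assumes "m \<ge> 2" and "n \<ge> 2"
  shows "partition_zeta_converges (partitions_into (positive_multiples m)) (real n)
    \<and> (\<lambda>k. riemann_zeta (real k) / (real k * real m ^ k)) summable_on {k::nat. k \<ge> 2 \<and> n dvd k}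
    \<and> ln (partition_zeta (partitions_into (positive_multiples m)) (real n))
      = real n * (\<Sum>\<^sub>\<infinity>k\<in>{k::nat. k \<ge> 2 \<and> n dvd k}. riemann_zeta (real k) / (real k * real m ^ k))"
proof -
  let ?S = "positive_multiples m"
  let ?K = "{k::nat. k \<ge> 2 \<and> n dvd k}"
  let ?g = "\<lambda>k. riemann_zeta (real k) / (real k * real m ^ k)"
  obtain L where L: "((\<lambda>j. - ln (1 - real (m * j) powr - real n)) has_sum L) {1..}"
    and Z: "((\<lambda>l. riemann_zeta (real (n * l)) / (real l * real m ^ (n * l))) has_sum L) {1..}"
    using has_sum_zeta_of_has_sum_ln[OF assms] by blast
  have S_ge: "2 \<le> i" if "i \<in> ?S" for i
    using that assms mult_mono[of 2 m 1] by (fastforce simp: positive_multiples_def)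
  have partitions: "partitions_into ?S = {p. set_mset p \<subseteq> ?S}"
    using S_ge by (fastforce simp: partitions_into_def)
  have "bij_betw (\<lambda>j. m * j) {1..} ?S"
    using assms by (auto simp: bij_betw_def positive_multiples_def inj_on_def)
  from has_sum_reindex_bij_betw[OF this, of "\<lambda>i. - ln (1 - real i powr - real n)"] L
  have "((\<lambda>i. - ln (1 - real i powr - real n)) has_sum L) ?S" by simp
  moreover have "real i powr - real n < 1" if "i \<in> ?S" for i
    using S_ge[OF that] assms by (simp add: powr_less_one)
  ultimately have euler: "((\<lambda>p. real (partition_norm p) powr - real n) has_sum exp L) (partitions_into ?S)"
    unfolding powr_partition_norm partitions by (intro has_sum_multisets) auto
  have "((\<lambda>l. ?g (n * l)) has_sum (L / real n)) {1..}"
    using has_sum_divide_const[OF Z, of "real n"] by (simp add: mult_ac)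
  moreover have "bij_betw (\<lambda>l. n * l) {1..} ?K"
  proof (rule bij_betwI[where g = "\<lambda>k. k div n"])
    show "(\<lambda>l. n * l) \<in> {1..} \<rightarrow> ?K" using assms mult_mono[of 2 n 1] by fastforce
    show "(\<lambda>k. k div n) \<in> ?K \<rightarrow> {1..}" using assms by (auto simp: Suc_le_eq div_greater_zero_iff dest: dvd_imp_le)
  qed (use assms in auto)
  ultimately have zeta: "(?g has_sum (L / real n)) ?K"
    using has_sum_reindex_bij_betw[of "\<lambda>l. n * l" "{1..}" ?K ?g "L / real n"] by simp
  show ?thesis
    using euler zeta infsumI[OF euler] infsumI[OF zeta] assms
    by (auto simp: partition_zeta_converges_def partition_zeta_def dest: has_sum_imp_summable)
qed

end
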